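(* Let $K$ be a finite field with cardinality $q$, let $\alpha\in K$ with $\alpha\ne 0$, and let $L_2$ be the three-dimensional Leibniz algebra over $K$ with basis $\{e_1,e_2,e_3\}$ and nonzero products of basis elements $e_1e_3=\alpha e_1$, $e_3e_2=e_2$, $e_2e_3=-e_2$. Then the polynomials \[ (x_1x_2)(x_3x_4), \] \[ s_3(x_1,x_2,x_3)=x_1x_2x_3-x_1x_3x_2-x_2x_1x_3+x_2x_3x_1+x_3x_1x_2-x_3x_2x_1, \] \[ x^{q+1}-x^2, \] \[ x_1x_2^{(2)}x_3-x_3x_2^{(2)}x_1x_3^{(q-1)}+x_3^{(q)}x_2^{(2)}x_1-x_1x_3^{(q)}x_2^{(2)}, \] \[ x_1x_2^{(2)}x_3x_1^{(q-1)}-x_1x_2^{(2)}x_3-x_1x_3^{(q)}x_2^{(2)}x_1^{(q-1)}+x_1x_3^{(q)}x_2^{(2)}, \] \[ x_1x_2^{(q)}x_1^{(q-1)}-x_1x_2x_1^{(q-1)}-x_1x_2^{(q)}+x_1x_2 \] form a basis of the $T$-ideal of identities of $L_2$, i.e. they generate $T(L_2)$ as a $T$-ideal.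
   Context: A (right) Leibniz algebra over $K$ is a $K$-algebra satisfying $x(yz)=(xy)z-(xz)y$. Identities live in the free Leibniz algebra $\mathcal L\langle X\rangle$ over $K$ on a countable set $X$ of variables; $T(L)$ is the set of polynomials vanishing under all substitutions of elements of $L$. A $T$-ideal is an ideal invariant under all endomorphisms of $\mathcal L\langle X\rangle$; a set $S$ is a basis of a $T$-ideal $I$ if $I$ is the smallest $T$-ideal containing $S$. Products without brackets are left-normed, $a_1a_2\cdots a_m=(\cdots((a_1a_2)a_3)\cdots)a_m$, and $x^{(m)}$ means $m$ consecutive occurrences of $x$ in such a left-normed product (e.g. $x_1x_2^{(2)}x_3=((x_1x_2)x_2)x_3$, $x_3^{(q)}x_2=x_3x_3\cdots x_3x_2$ with $q$ copies of $x_3$). $x^{m}$ for a single variable is the left-normed power $xx\cdots x$ ($m$ factors). Products of basis elements not listed are zero. *)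

theory Defs
  imports
    Complex_Main
    "HOL-Library.Poly_Mapping"
    "HOL-Library.Cardinality"
    "HOL-Library.Product_Plus"
begin

section \<open>Leibniz algebras\<close>

definition (in vector_space) is_basis :: "'b set \<Rightarrow> bool"
  where "is_basis B \<longleftrightarrow> independent B \<and> span B = UNIV"

locale leibniz_algebra = vector_space scale
  for scale :: "'k::field \<Rightarrow> 'a::ab_group_add \<Rightarrow> 'a" +
  fixes mult :: "'a \<Rightarrow> 'a \<Rightarrow> 'a"
  assumes mult_add_left: "mult (x + y) z = mult x z + mult y z"
    and mult_add_right: "mult x (y + z) = mult x y + mult x z"
    and mult_scale_left: "mult (scale c x) y = scale c (mult x y)"
    and mult_scale_right: "mult x (scale c y) = scale c (mult x y)"
    and leibniz: "mult x (mult y z) = mult (mult x y) z - mult (mult x z) y"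
definition algebra_hom ::
  "('k::field \<Rightarrow> 'a::ab_group_add \<Rightarrow> 'a) \<Rightarrow> ('a \<Rightarrow> 'a \<Rightarrow> 'a) \<Rightarrow>
   ('k \<Rightarrow> 'b::ab_group_add \<Rightarrow> 'b) \<Rightarrow> ('b \<Rightarrow> 'b \<Rightarrow> 'b) \<Rightarrow> ('a \<Rightarrow> 'b) \<Rightarrow> bool"
  where "algebra_hom s1 m1 s2 m2 h \<longleftrightarrow>
    Vector_Spaces.linear s1 s2 h \<and> (\<forall>x y. h (m1 x y) = m2 (h x) (h y))"


section \<open>The free nonassociative algebra\<close>

text \<open>Bracketed words in the variables with indices 0, 1, 2, and so on\<close>

datatype word = Letter nat | Prod word word

type_synonym 'k na_poly = "word \<Rightarrow>\<^sub>0 'k"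

lift_definition na_scale :: "'k::field \<Rightarrow> 'k na_poly \<Rightarrow> 'k na_poly"
  is "\<lambda>c p w. c * p w"
  by (erule finite_subset[rotated]) auto

text \<open>The coefficient of \<open>Prod s t\<close> in a product can only arise in one way.\<close>

lift_definition na_mult :: "'k::field na_poly \<Rightarrow> 'k na_poly \<Rightarrow> 'k na_poly"
  is "\<lambda>p q w. case w of Letter i \<Rightarrow> 0 | Prod s t \<Rightarrow> p s * q t"
proof -
  fix p q :: "word \<Rightarrow> 'k"
  assume "finite {w. p w \<noteq> 0}" "finite {w. q w \<noteq> 0}"
  then have "finite ((\<lambda>(s, t). Prod s t) ` ({w. p w \<noteq> 0} \<times> {w. q w \<noteq> 0}))"
    by blast
  then show "finite {w. (case w of Letter i \<Rightarrow> 0 | Prod s t \<Rightarrow> p s * q t) \<noteq> 0}"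
    by (rule finite_subset[rotated]) (force split: word.splits)
qed

fun word_eval :: "('a \<Rightarrow> 'a \<Rightarrow> 'a) \<Rightarrow> (nat \<Rightarrow> 'a) \<Rightarrow> word \<Rightarrow> 'a"
  where
    "word_eval mult v (Letter i) = v i"
  | "word_eval mult v (Prod s t) = mult (word_eval mult v s) (word_eval mult v t)"

definition na_eval ::
  "('k::field \<Rightarrow> 'a::ab_group_add \<Rightarrow> 'a) \<Rightarrow> ('a \<Rightarrow> 'a \<Rightarrow> 'a) \<Rightarrow> (nat \<Rightarrow> 'a) \<Rightarrow> 'k na_poly \<Rightarrow> 'a"
  where "na_eval scale mult v p =
    (\<Sum>w\<in>Poly_Mapping.keys p. scale (Poly_Mapping.lookup p w) (word_eval mult v w))"

lemma lookup_na_scale: "Poly_Mapping.lookup (na_scale c p) w = c * Poly_Mapping.lookup p w"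
  by transfer simp

lemma lookup_na_mult:
  "Poly_Mapping.lookup (na_mult p q) w =
    (case w of Letter i \<Rightarrow> 0 | Prod s t \<Rightarrow> Poly_Mapping.lookup p s * Poly_Mapping.lookup q t)"
  by transfer simp

lemmas na_lookup = lookup_na_scale lookup_na_mult lookup_add lookup_minus

lemma na_mult_add_left: "na_mult (p + q) r = na_mult p r + na_mult q r"
  by (rule poly_mapping_eqI) (auto simp: na_lookup algebra_simps split: word.split)

lemma na_mult_add_right: "na_mult p (q + r) = na_mult p q + na_mult p r"
  by (rule poly_mapping_eqI) (auto simp: na_lookup algebra_simps split: word.split)

lemma na_mult_diff_left: "na_mult (p - q) r = na_mult p r - na_mult q r"
  by (rule poly_mapping_eqI) (auto simp: na_lookup algebra_simps split: word.split)

lemma na_mult_diff_right: "na_mult p (q - r) = na_mult p q - na_mult p r"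
  by (rule poly_mapping_eqI) (auto simp: na_lookup algebra_simps split: word.split)

lemma na_mult_scale_left: "na_mult (na_scale c p) q = na_scale c (na_mult p q)"
  by (rule poly_mapping_eqI) (auto simp: na_lookup algebra_simps split: word.split)

lemma na_mult_scale_right: "na_mult p (na_scale c q) = na_scale c (na_mult p q)"
  by (rule poly_mapping_eqI) (auto simp: na_lookup algebra_simps split: word.split)

lemma na_scale_diff: "na_scale c (p - q) = na_scale c p - na_scale c q"
  by (rule poly_mapping_eqI) (auto simp: na_lookup algebra_simps)

interpretation na: vector_space na_scale
  by unfold_locales (rule poly_mapping_eqI, simp add: na_lookup algebra_simps)+


section \<open>The free Leibniz algebra\<close>

inductive_set leibniz_ideal :: "'k::field na_poly set"
  where
    gen: "na_mult p (na_mult q r) - (na_mult (na_mult p q) r - na_mult (na_mult p r) q)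
            \<in> leibniz_ideal"
  | add: "p \<in> leibniz_ideal \<Longrightarrow> q \<in> leibniz_ideal \<Longrightarrow> p + q \<in> leibniz_ideal"
  | scale: "p \<in> leibniz_ideal \<Longrightarrow> na_scale c p \<in> leibniz_ideal"
  | mult_left: "p \<in> leibniz_ideal \<Longrightarrow> na_mult q p \<in> leibniz_ideal"
  | mult_right: "p \<in> leibniz_ideal \<Longrightarrow> na_mult p q \<in> leibniz_ideal"

lemma leibniz_ideal_zero: "0 \<in> leibniz_ideal"
  using leibniz_ideal.scale[OF leibniz_ideal.gen, of 0] by simp

lemma leibniz_ideal_uminus: "p \<in> leibniz_ideal \<Longrightarrow> - p \<in> leibniz_ideal"
  using leibniz_ideal.scale[of p "-1"] by simp

lemma leibniz_ideal_diff:
  "p \<in> leibniz_ideal \<Longrightarrow> q \<in> leibniz_ideal \<Longrightarrow> p - q \<in> leibniz_ideal"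
  using leibniz_ideal.add[OF _ leibniz_ideal_uminus, of p q] by simp

quotient_type (overloaded) 'k leib = "('k::field) na_poly" / "\<lambda>p q. p - q \<in> leibniz_ideal"
proof (rule equivpI)
  show "reflp (\<lambda>p q :: 'k na_poly. p - q \<in> leibniz_ideal)"
    by (simp add: reflp_def leibniz_ideal_zero)
  show "symp (\<lambda>p q :: 'k na_poly. p - q \<in> leibniz_ideal)"
    unfolding symp_def using leibniz_ideal_uminus by (metis minus_diff_eq)
  show "transp (\<lambda>p q :: 'k na_poly. p - q \<in> leibniz_ideal)"
    unfolding transp_def using leibniz_ideal.add by (metis diff_add_cancel add_diff_eq)
qed

instantiation leib :: (field) "{ab_group_add, times}"
begin

lift_definition zero_leib :: "'a leib" is 0 .

lift_definition plus_leib :: "'a leib \<Rightarrow> 'a leib \<Rightarrow> 'a leib" is "(+)"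
  by (metis add_diff_add leibniz_ideal.add)

lift_definition minus_leib :: "'a leib \<Rightarrow> 'a leib \<Rightarrow> 'a leib" is "(-)"
  by (metis diff_diff_eq2 diff_add_eq add.commute diff_diff_eq leibniz_ideal_diff)

lift_definition uminus_leib :: "'a leib \<Rightarrow> 'a leib" is uminus
  by (metis leibniz_ideal_uminus minus_diff_commute minus_diff_minus)

lift_definition times_leib :: "'a leib \<Rightarrow> 'a leib \<Rightarrow> 'a leib" is na_mult
proof -
  fix p p' q q' :: "'a na_poly"
  assume "p - p' \<in> leibniz_ideal" "q - q' \<in> leibniz_ideal"
  then have "na_mult (p - p') q + na_mult p' (q - q') \<in> leibniz_ideal"
    by (intro leibniz_ideal.intros)
  then show "na_mult p q - na_mult p' q' \<in> leibniz_ideal"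
    by (simp add: na_mult_diff_left na_mult_diff_right)
qed

instance
  by standard (transfer, simp add: algebra_simps leibniz_ideal_zero)+

end

lift_definition leib_scale :: "'k::field \<Rightarrow> 'k leib \<Rightarrow> 'k leib" is na_scale
  by (metis leibniz_ideal.scale na_scale_diff)

lift_definition var :: "nat \<Rightarrow> 'k::field leib" is "\<lambda>i. Poly_Mapping.single (Letter i) 1" .

interpretation free_leibniz: leibniz_algebra "leib_scale :: 'k::field \<Rightarrow> _" "(*)"
proof
  show "x * (y * z) = x * y * z - x * z * y" for x y z :: "'k leib"
    by transfer (rule leibniz_ideal.gen)
qed (transfer, simp add: na.scale_right_distrib na.scale_left_distrib na_mult_add_left
      na_mult_add_right na_mult_scale_left na_mult_scale_right leibniz_ideal_zero)+

text \<open>Substitution of \<open>v i\<close> for the \<open>i\<close>-th variable. The value does not depend on the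
  representative when the target is a Leibniz algebra, see \<open>leib_eval_hom\<close> and
  \<open>leib_eval_unique\<close> below.\<close>

definition leib_eval ::
  "('k::field \<Rightarrow> 'a::ab_group_add \<Rightarrow> 'a) \<Rightarrow> ('a \<Rightarrow> 'a \<Rightarrow> 'a) \<Rightarrow> (nat \<Rightarrow> 'a) \<Rightarrow> 'k leib \<Rightarrow> 'a"
  where "leib_eval scale mult v f = na_eval scale mult v (rep_leib f)"

context leibniz_algebra
begin

lemma na_eval_superset:
  assumes "finite A" "Poly_Mapping.keys p \<subseteq> A"
  shows "na_eval scale mult v p = (\<Sum>w\<in>A. scale (Poly_Mapping.lookup p w) (word_eval mult v w))"
  unfolding na_eval_def
  by (rule sum.mono_neutral_left) (use assms in \<open>auto simp: in_keys_iff\<close>)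

lemma na_eval_add: "na_eval scale mult v (p + q) = na_eval scale mult v p + na_eval scale mult v q"
proof -
  have "finite (Poly_Mapping.keys p \<union> Poly_Mapping.keys q)" "Poly_Mapping.keys (p + q) \<subseteq> Poly_Mapping.keys p \<union> Poly_Mapping.keys q"
    using keys_add[of p q] by auto
  then show ?thesis
    by (simp add: na_eval_superset[of "Poly_Mapping.keys p \<union> Poly_Mapping.keys q"] lookup_add scale_left_distrib
        sum.distrib)
qed

lemma na_eval_scale: "na_eval scale mult v (na_scale c p) = scale c (na_eval scale mult v p)"
proof -
  have "Poly_Mapping.keys (na_scale c p) \<subseteq> Poly_Mapping.keys p"
    by (auto simp: in_keys_iff lookup_na_scale)
  then show ?thesis
    by (simp add: na_eval_superset[of "Poly_Mapping.keys p"] lookup_na_scale scale_sum_right)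
qed

lemma na_eval_diff: "na_eval scale mult v (p - q) = na_eval scale mult v p - na_eval scale mult v q"
  using na_eval_add[of v "p - q" q] by simp

lemma mult_sum_left: "mult (sum f A) y = (\<Sum>a\<in>A. mult (f a) y)"
proof (cases "finite A")
  case True
  then show ?thesis
    using mult_scale_left[of 0 0 y] by induction (simp_all add: mult_add_left)
qed (use mult_scale_left[of 0 0 y] in simp)

lemma mult_sum_right: "mult x (sum f A) = (\<Sum>a\<in>A. mult x (f a))"
proof (cases "finite A")
  case True
  then show ?thesis
    using mult_scale_right[of x 0 0] by induction (simp_all add: mult_add_right)
qed (use mult_scale_right[of x 0 0] in simp)

lemma na_eval_mult:
  "na_eval scale mult v (na_mult p q) = mult (na_eval scale mult v p) (na_eval scale mult v q)"
proof -
  let ?P = "\<lambda>(s, t). Prod s t"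
  let ?A = "?P ` (Poly_Mapping.keys p \<times> Poly_Mapping.keys q)"
  have "Poly_Mapping.keys (na_mult p q) \<subseteq> ?A"
    by (force simp: in_keys_iff lookup_na_mult split: word.splits)
  then have "na_eval scale mult v (na_mult p q) =
      (\<Sum>w\<in>?A. scale (Poly_Mapping.lookup (na_mult p q) w) (word_eval mult v w))"
    by (intro na_eval_superset) auto
  also have "\<dots> = (\<Sum>(s, t)\<in>Poly_Mapping.keys p \<times> Poly_Mapping.keys q.
      scale (Poly_Mapping.lookup p s * Poly_Mapping.lookup q t) (mult (word_eval mult v s) (word_eval mult v t)))"
    by (subst sum.reindex) (auto simp: inj_on_def lookup_na_mult intro!: sum.cong)
  also have "\<dots> = (\<Sum>s\<in>Poly_Mapping.keys p. \<Sum>t\<in>Poly_Mapping.keys q.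
      mult (scale (Poly_Mapping.lookup p s) (word_eval mult v s)) (scale (Poly_Mapping.lookup q t) (word_eval mult v t)))"
    by (simp add: sum.cartesian_product mult_scale_left mult_scale_right mult.commute)
  also have "\<dots> = mult (na_eval scale mult v p) (na_eval scale mult v q)"
    by (simp add: na_eval_def mult_sum_left mult_sum_right) (rule sum.swap)
  finally show ?thesis .
qed

lemma na_eval_leibniz_ideal: "p \<in> leibniz_ideal \<Longrightarrow> na_eval scale mult v p = 0"
proof (induction rule: leibniz_ideal.induct)
  case (gen p q r)
  then show ?case by (simp add: na_eval_diff na_eval_mult leibniz)
next
  case (mult_left p q)
  then show ?case using mult_sum_right[of _ _ "{}"] by (simp add: na_eval_mult)
next
  case (mult_right p q)
  then show ?case using mult_sum_left[of _ "{}"] by (simp add: na_eval_mult)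
qed (simp_all add: na_eval_add na_eval_scale)

lemma leib_eval_abs: "leib_eval scale mult v (abs_leib p) = na_eval scale mult v p"
proof -
  have "rep_leib (abs_leib p) - p \<in> leibniz_ideal"
    by (rule Quotient_rep_abs[OF Quotient_leib]) (simp add: leibniz_ideal_zero)
  then show ?thesis
    using na_eval_leibniz_ideal[of "rep_leib (abs_leib p) - p"] by (simp add: leib_eval_def na_eval_diff)
qed

lemma leib_eval_var: "leib_eval scale mult v (var i) = v i"
  by (simp add: var.abs_eq leib_eval_abs na_eval_def)

lemma leib_eval_hom: "algebra_hom leib_scale (*) scale mult (leib_eval scale mult v)"
proof -
  have add: "leib_eval scale mult v (f + g) = leib_eval scale mult v f + leib_eval scale mult v g" for f g
    by (induction f; induction g) (simp add: plus_leib.abs_eq leib_eval_abs na_eval_add)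
  have sc: "leib_eval scale mult v (leib_scale c f) = scale c (leib_eval scale mult v f)" for c f
    by (induction f) (simp add: leib_scale.abs_eq leib_eval_abs na_eval_scale)
  have mu: "leib_eval scale mult v (f * g) = mult (leib_eval scale mult v f) (leib_eval scale mult v g)" for f g
    by (induction f; induction g) (simp add: times_leib.abs_eq leib_eval_abs na_eval_mult)
  have "Vector_Spaces.linear leib_scale scale (leib_eval scale mult v)"
    by unfold_locales (simp_all add: add sc)
  with mu show ?thesis
    by (simp add: algebra_hom_def)
qed

lemma leib_eval_unique:
  assumes h: "algebra_hom leib_scale (*) scale mult h" and v: "\<And>i. h (var i) = v i"
  shows "h = leib_eval scale mult v"
proof
  fix f
  interpret h: Vector_Spaces.linear leib_scale scale h
    using h by (simp add: algebra_hom_def)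
  have word: "h (abs_leib (Poly_Mapping.single w 1)) = word_eval mult v w" for w
  proof (induction w)
    case (Letter i)
    then show ?case using v[of i] by (simp add: var.abs_eq)
  next
    case (Prod s t)
    have "Poly_Mapping.single (Prod s t) 1 =
        na_mult (Poly_Mapping.single s 1) (Poly_Mapping.single t (1::'k))"
      by (rule poly_mapping_eqI)
        (auto simp: lookup_na_mult lookup_single when_def split: word.split)
    with Prod h show ?case
      by (simp add: algebra_hom_def flip: times_leib.abs_eq)
  qed
  have "h (abs_leib p) = na_eval scale mult v p" for p
  proof -
    have p: "p = (\<Sum>w\<in>Poly_Mapping.keys p. na_scale (Poly_Mapping.lookup p w) (Poly_Mapping.single w 1))"
      by (rule poly_mapping_eqI)
        (auto simp: lookup_sum lookup_na_scale lookup_single when_def in_keys_iff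
          if_distrib cong: if_cong)
    have abs_sum: "abs_leib (sum g A) = (\<Sum>w\<in>A. abs_leib (g w))" if "finite A"
      for g :: "word \<Rightarrow> 'k na_poly" and A
      using that by induction (simp_all add: zero_leib.abs_eq flip: plus_leib.abs_eq)
    show ?thesis
      by (subst p) (simp add: abs_sum h.sum h.scale word na_eval_def flip: leib_scale.abs_eq)
  qed
  then show "h f = leib_eval scale mult v f"
    by (induction f) (simp add: leib_eval_abs)
qed

end


section \<open>Identities and T-ideals\<close>

definition identities ::
  "('k::field \<Rightarrow> 'a::ab_group_add \<Rightarrow> 'a) \<Rightarrow> ('a \<Rightarrow> 'a \<Rightarrow> 'a) \<Rightarrow> 'k leib set"
  where "identities scale mult = {f. \<forall>v. leib_eval scale mult v f = 0}"

definition T_ideal :: "'k::field leib set \<Rightarrow> bool"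
  where "T_ideal I \<longleftrightarrow>
    free_leibniz.subspace I \<and>
    (\<forall>f\<in>I. \<forall>g. f * g \<in> I \<and> g * f \<in> I) \<and>
    (\<forall>h. algebra_hom leib_scale (*) leib_scale (*) h \<longrightarrow> h ` I \<subseteq> I)"

definition T_ideal_basis :: "'k::field leib set \<Rightarrow> 'k leib set \<Rightarrow> bool"
  where "T_ideal_basis S I \<longleftrightarrow>
    T_ideal I \<and> S \<subseteq> I \<and> (\<forall>J. T_ideal J \<and> S \<subseteq> J \<longrightarrow> I \<subseteq> J)"

text \<open>The left-normed product of a nonempty list; the value at \<open>[]\<close> is irrelevant.\<close>

fun lnprod :: "'k::field leib list \<Rightarrow> 'k leib"
  where
    "lnprod [] = 0"
  | "lnprod (f # fs) = foldl (*) f fs"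


section \<open>An algebra with the prescribed multiplication table exists\<close>

definition triple_scale :: "'k::field \<Rightarrow> 'k \<times> 'k \<times> 'k \<Rightarrow> 'k \<times> 'k \<times> 'k"
  where "triple_scale c = (\<lambda>(x, y, z). (c * x, c * y, c * z))"

definition triple_mult :: "'k::field \<Rightarrow> 'k \<times> 'k \<times> 'k \<Rightarrow> 'k \<times> 'k \<times> 'k \<Rightarrow> 'k \<times> 'k \<times> 'k"
  where "triple_mult \<alpha> = (\<lambda>(x, y, z) (x', y', z'). (\<alpha> * x * z', z * y' - y * z', 0))"

lemma leibniz_algebra_triple: "leibniz_algebra triple_scale (triple_mult \<alpha>)"
  by unfold_locales
    (simp_all add: triple_scale_def triple_mult_def case_prod_beta prod_eq_iff algebra_simps)

lemma is_basis_triple: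
  fixes \<alpha> :: "'k::field"
  shows "vector_space.is_basis triple_scale {(1, 0, 0), (0, 1, 0), (0, 0, 1 :: 'k)}"
proof -
  interpret leibniz_algebra triple_scale "triple_mult \<alpha>"
    by (rule leibniz_algebra_triple)
  have "v \<in> span {(1, 0, 0), (0, 1, 0), (0, 0, 1 :: 'k)}" for v
  proof -
    obtain a b c where v: "v = (a, b, c)" by (cases v)
    have "v = triple_scale a (1, 0, 0) + (triple_scale b (0, 1, 0) + triple_scale c (0, 0, 1))"
      by (simp add: v triple_scale_def)
    also have "\<dots> \<in> span {(1, 0, 0), (0, 1, 0), (0, 0, 1)}"
      by (intro span_add span_scale span_base) auto
    finally show ?thesis .
  qed
  moreover have "independent {(1, 0, 0), (0, 1, 0), (0, 0, 1 :: 'k)}"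
    by (rule independent_if_scalars_zero) (auto simp: triple_scale_def zero_prod_def)
  ultimately show ?thesis
    by (auto simp: is_basis_def)
qed

lemma triple_mult_table:
  fixes \<alpha> :: "'k::field"
  defines "e1 \<equiv> (1, 0, 0)" and "e2 \<equiv> (0, 1, 0)" and "e3 \<equiv> (0, 0, 1)"
  shows "triple_mult \<alpha> e1 e3 = triple_scale \<alpha> e1"
    and "triple_mult \<alpha> e3 e2 = e2"
    and "triple_mult \<alpha> e2 e3 = - e2"
    and "triple_mult \<alpha> e1 e1 = 0" "triple_mult \<alpha> e1 e2 = 0" "triple_mult \<alpha> e2 e1 = 0"
    and "triple_mult \<alpha> e2 e2 = 0" "triple_mult \<alpha> e3 e1 = 0" "triple_mult \<alpha> e3 e3 = 0"
  by (simp_all add: e1_def e2_def e3_def triple_mult_def triple_scale_def zero_prod_def)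

end

theory Submission
  imports Defs "HOL-Computational_Algebra.Polynomial"
begin

text \<open>Completeness already follows from the first and the last identity. Let \<open>J\<close> be a T-ideal
  containing them, without loss of generality inside the identities of \<open>L\<^sub>2\<close>, and write \<open>F\<close> for
  the free algebra modulo \<open>J\<close>. The first identity makes the right multiplications \<open>R\<^sub>x\<close> commute on
  \<open>F\<^sup>2\<close>, and the last one, with an element of \<open>F\<^sup>2\<close> for its first variable, makes \<open>R\<^sub>x\<^sup>q = R\<^sub>x\<close> there. So
  \<open>F\<^sup>2\<close> is a sum of simultaneous eigenspaces, one for each point \<open>\<tau>\<close> with coordinates in the field,
  and the projection of any element to one of them is \<open>\<Sum> \<gamma>\<^sub>i\<^sub>j P(x\<^sub>i x\<^sub>j)\<close>, where \<open>P\<close> is the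
  projection. If this is an identity of \<open>L\<^sub>2\<close>, evaluation at
  \<open>x\<^sub>i = a\<^sub>i e\<^sub>1 + (\<tau>\<^sub>i / \<alpha>) e\<^sub>3\<close> and at \<open>x\<^sub>i = b\<^sub>i e\<^sub>2 - \<tau>\<^sub>i e\<^sub>3\<close> shows that \<open>\<tau>\<close> lies in both kernels of
  the bilinear form \<open>\<gamma>\<close>. On the other hand the last identity gives \<open>P(x y) = 0\<close> for linear forms
  \<open>x\<close>, \<open>y\<close> vanishing at \<open>\<tau>\<close>, and the two facts together give \<open>\<Sum> \<gamma>\<^sub>i\<^sub>j P(x\<^sub>i x\<^sub>j) = 0\<close>.\<close>

section \<open>Functions on a finite field\<close>

text \<open>Multiplication by a nonzero \<open>c\<close> permutes the nonzero elements; comparing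
  the two products over them gives \<open>c ^ (CARD('k) - 1) = 1\<close>.\<close>

lemma finite_field_power_card:
  fixes c :: "'k::{field,finite}"
  shows "c ^ CARD('k) = c"
proof (cases "c = 0")
  case False
  let ?U = "UNIV - {0::'k}"
  have "bij_betw ((*) c) ?U ?U"
    by (rule bij_betw_byWitness[where f' = "(*) (inverse c)"])
      (use False in \<open>auto simp: mult.assoc[symmetric]\<close>)
  then have "prod (\<lambda>x. x) ?U = prod (\<lambda>x. c * x) ?U"
    using prod.reindex_bij_betw[of "(*) c" ?U ?U "\<lambda>x. x"] by simp
  also have "\<dots> = c ^ (CARD('k) - 1) * prod (\<lambda>x. x) ?U"
    by (simp add: prod.distrib)
  finally have "c ^ (CARD('k) - 1) = 1"
    by simp
  then have "c * c ^ (CARD('k) - 1) = c"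
    by simp
  then show ?thesis
    by (simp flip: power_Suc)
qed (simp add: zero_power)

lemma card_field_ge_2: "CARD('k::{field,finite}) \<ge> 2"
proof -
  have "card {0, 1::'k} \<le> CARD('k)"
    by (rule card_mono) auto
  then show ?thesis
    by simp
qed

lemma card_field_Suc_Suc:
  obtains m where "CARD('k::{field,finite}) = Suc (Suc m)"
  using card_field_ge_2[where 'k='k] le_Suc_ex[of 2 "CARD('k)"] by auto

text \<open>The remainder modulo \<open>X^q - X\<close> has degree below \<open>q\<close> but
  \<open>q\<close> roots, so it is zero.\<close>

lemma field_poly_dvd_vanishing:
  fixes p :: "'k::{field,finite} poly"
  assumes "\<And>c. poly p c = 0"
  shows "monom 1 CARD('k) - monom 1 1 dvd p"
proof -
  let ?m = "monom 1 CARD('k) - monom 1 1 :: 'k poly"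
  have deg: "degree ?m = CARD('k)"
  proof -
    have "degree (monom 1 CARD('k) + - monom 1 1 :: 'k poly) = degree (monom 1 CARD('k) :: 'k poly)"
      by (rule degree_add_eq_left) (use card_field_ge_2[where 'k='k] in \<open>simp add: degree_monom_eq\<close>)
    then show ?thesis
      by (simp add: degree_monom_eq)
  qed
  have "poly (p mod ?m) c = 0" for c
  proof -
    have "poly p c = poly (p div ?m) c * poly ?m c + poly (p mod ?m) c"
      by (metis div_mult_mod_eq poly_add poly_mult)
    then show ?thesis
      using assms finite_field_power_card[of c] by (simp add: poly_monom)
  qed
  then have roots: "{c. poly (p mod ?m) c = 0} = UNIV"
    by auto
  have "p mod ?m = 0"
  proof (rule ccontr)
    assume nz: "p mod ?m \<noteq> 0"
    then have "card {c. poly (p mod ?m) c = 0} \<le> degree (p mod ?m)"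
      by (rule card_poly_roots_bound)
    moreover have "degree (p mod ?m) < CARD('k)"
      using degree_mod_less'[OF _ nz] deg card_field_ge_2[where 'k='k]
      by (metis degree_0 not_numeral_le_zero)
    ultimately show False
      unfolding roots by simp
  qed
  then show ?thesis
    by (rule mod_0_imp_dvd)
qed

text \<open>The indicator function of \<open>c\<close> as a polynomial. At an operator
  \<open>R\<close> with \<open>R^q = R\<close> it becomes the projection to the eigenspace of
  \<open>c\<close>.\<close>

definition point_poly :: "'k::{field,finite} \<Rightarrow> 'k poly"
  where "point_poly c = 1 - [:- c, 1:] ^ (CARD('k) - 1)"

lemma poly_point_poly: "poly (point_poly c) d = (if d = c then 1 else 0)"
proof (cases "d = c")
  case False
  have "(d - c) * (d - c) ^ (CARD('a) - 1) = d - c"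
    using finite_field_power_card[of "d - c"] by (simp flip: power_Suc)
  then show ?thesis
    using False by (simp add: point_poly_def)
qed (use card_field_ge_2[where 'k='a] in \<open>simp add: point_poly_def\<close>)


section \<open>Right multiplications\<close>

context leibniz_algebra
begin

lemma mult_zero [simp]: "mult 0 x = 0" "mult x 0 = 0"
  using mult_scale_left[of 0 0 x] mult_scale_right[of x 0 0] by auto

lemma mult_diff_left: "mult (x - y) z = mult x z - mult y z"
  using mult_add_left[of "x - y" y z] by simp

lemma mult_diff_right: "mult x (y - z) = mult x y - mult x z"
  using mult_add_right[of x "y - z" z] by simp

end

lemma algebra_hom_foldl:
  "algebra_hom s1 m1 s2 m2 h \<Longrightarrow> h (foldl m1 u xs) = foldl m2 (h u) (map h xs)"
  by (induction xs arbitrary: u) (auto simp: algebra_hom_def)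

lemma algebra_hom_linear: "algebra_hom s1 m1 s2 m2 h \<Longrightarrow> Vector_Spaces.linear s1 s2 h"
  by (simp add: algebra_hom_def)

lemma algebra_hom_mult: "algebra_hom s1 m1 s2 m2 h \<Longrightarrow> h (m1 x y) = m2 (h x) (h y)"
  by (simp add: algebra_hom_def)

text \<open>Horner's scheme for \<open>p\<close> at the operator of right multiplication by
  \<open>x\<close>, applied to \<open>u\<close>.\<close>

definition right_act :: "'k::field leib \<Rightarrow> 'k poly \<Rightarrow> 'k leib \<Rightarrow> 'k leib"
  where "right_act x p u = fold_coeffs (\<lambda>a w. leib_scale a u + w * x) p 0"

lemma right_act_0 [simp]: "right_act x 0 u = 0"
  by (simp add: right_act_def)

lemma right_act_pCons [simp]: "right_act x (pCons a p) u = leib_scale a u + right_act x p u * x"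
  by (cases "p = 0 \<and> a = 0") (auto simp: right_act_def)

lemma right_act_add: "right_act x (p + r) u = right_act x p u + right_act x r u"
proof (induction p r rule: poly_induct2)
  case (pCons a p b r)
  then show ?case
    by (simp add: free_leibniz.scale_left_distrib free_leibniz.mult_add_left algebra_simps)
qed simp

lemma right_act_smult: "right_act x (smult a p) u = leib_scale a (right_act x p u)"
  by (induction p)
    (simp_all add: free_leibniz.scale_right_distrib free_leibniz.mult_scale_left)

lemma right_act_diff: "right_act x (p - r) u = right_act x p u - right_act x r u"
  using right_act_add[of x "p - r" r u] by simp

lemma right_act_sum: "right_act x (sum p A) u = (\<Sum>a\<in>A. right_act x (p a) u)"
  by (induction A rule: infinite_finite_induct) (simp_all add: right_act_add)

lemma right_act_1 [simp]: "right_act x 1 u = u"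
  by (simp add: one_pCons)

lemma right_act_mult: "right_act x (p * r) u = right_act x p (right_act x r u)"
  by (induction p) (simp_all add: right_act_add right_act_smult)

lemma right_act_X: "right_act x [:0, 1:] u = u * x"
  by simp

lemma right_act_monom: "right_act x (monom 1 k) u = foldl (*) u (replicate k x)"
proof (induction k)
  case (Suc k)
  have "foldl (*) u (replicate (Suc k) x) = foldl (*) u (replicate k x @ [x])"
    by (simp only: replicate_append_same replicate_Suc)
  with Suc show ?case
    by (simp add: monom_Suc del: replicate_Suc)
qed (simp add: monom_0)

lemma right_act_linear:
  "right_act x p (u + w) = right_act x p u + right_act x p w"
  "right_act x p (leib_scale c u) = leib_scale c (right_act x p u)"
  by (induction p)
    (simp_all add: free_leibniz.scale_right_distrib free_leibniz.mult_add_left algebra_simps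
      free_leibniz.mult_scale_left free_leibniz.scale_left_commute)

section \<open>Projections to simultaneous eigenspaces\<close>

text \<open>Composes one indicator for each of the first \<open>n\<close> variables. The factors
  have a fixed order because right multiplications will commute only modulo an ideal.\<close>

primrec point_proj :: "(nat \<Rightarrow> 'k::{field,finite}) \<Rightarrow> nat \<Rightarrow> 'k leib \<Rightarrow> 'k leib"
  where
    "point_proj \<tau> 0 u = u"
  | "point_proj \<tau> (Suc n) u = point_proj \<tau> n (right_act (var n) (point_poly (\<tau> n)) u)"

lemma linear_point_proj: "Vector_Spaces.linear leib_scale leib_scale (point_proj \<tau> n)"
proof -
  have "point_proj \<tau> n (u + w) = point_proj \<tau> n u + point_proj \<tau> n w"
    and "point_proj \<tau> n (leib_scale c u) = leib_scale c (point_proj \<tau> n u)" for u w c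
    by (induction n arbitrary: u w) (simp_all add: right_act_linear)
  then show ?thesis
    by unfold_locales
qed

interpretation point_proj: Vector_Spaces.linear leib_scale leib_scale "point_proj \<tau> n" for \<tau> n
  by (rule linear_point_proj)

lemma point_proj_cong: "(\<And>i. i < n \<Longrightarrow> \<sigma> i = \<tau> i) \<Longrightarrow> point_proj \<sigma> n u = point_proj \<tau> n u"
  by (induction n arbitrary: u) simp_all

text \<open>Each \<open>v i\<close> acts on \<open>e\<close> with eigenvalue
  \<open>\<tau> i\<close>, so every factor multiplies by the indicator of \<open>\<tau> i\<close> at
  \<open>\<tau> i\<close>, which is 1.\<close>

lemma eval_point_proj:
  fixes scale :: "'k::{field,finite} \<Rightarrow> 'a::ab_group_add \<Rightarrow> 'a"
    and mult :: "'a \<Rightarrow> 'a \<Rightarrow> 'a"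
  assumes "leibniz_algebra scale mult" and e: "\<And>i. mult e (v i) = scale (\<tau> i) e"
    and "leib_eval scale mult v u = scale b e"
  shows "leib_eval scale mult v (point_proj \<tau> n u) = scale b e"
proof -
  interpret leibniz_algebra scale mult by fact
  interpret h: Vector_Spaces.linear leib_scale scale "leib_eval scale mult v"
    by (rule algebra_hom_linear[OF leib_eval_hom])
  have act: "leib_eval scale mult v (right_act (var i) p u) = scale (poly p (\<tau> i) * b) e"
    if "leib_eval scale mult v u = scale b e" for i p u
  proof (induction p)
    case (pCons c p)
    then show ?case
      by (simp add: that h.add h.scale algebra_hom_mult[OF leib_eval_hom] leib_eval_var
          mult_scale_left e algebra_simps)
  qed (simp add: h.zero)
  show ?thesis
    using assms(3) by (induction n arbitrary: u) (simp_all add: act poly_point_poly)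
qed


text \<open>The normal form of a projected product: \<open>\<gamma>\<close> is the matrix of a
  bilinear form in the first \<open>n\<close> variables.\<close>

definition proj_comb :: "(nat \<Rightarrow> 'k::{field,finite}) \<Rightarrow> nat \<Rightarrow> (nat \<Rightarrow> nat \<Rightarrow> 'k) \<Rightarrow> 'k leib"
  where "proj_comb \<tau> n \<gamma> =
    (\<Sum>i<n. \<Sum>j<n. leib_scale (\<gamma> i j) (point_proj \<tau> n (var i * var j)))"

lemma eval_proj_comb:
  fixes scale :: "'k::{field,finite} \<Rightarrow> 'a::ab_group_add \<Rightarrow> 'a"
    and mult :: "'a \<Rightarrow> 'a \<Rightarrow> 'a"
  assumes L: "leibniz_algebra scale mult" and e: "\<And>i. mult e (v i) = scale (\<tau> i) e"
    and b: "\<And>i j. mult (v i) (v j) = scale (b i j) e"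
  shows "leib_eval scale mult v (proj_comb \<tau> n \<gamma>) = scale (\<Sum>i<n. \<Sum>j<n. \<gamma> i j * b i j) e"
proof -
  interpret leibniz_algebra scale mult by fact
  interpret h: Vector_Spaces.linear leib_scale scale "leib_eval scale mult v"
    by (rule algebra_hom_linear[OF leib_eval_hom])
  have "leib_eval scale mult v (point_proj \<tau> n (var i * var j)) = scale (b i j) e" for i j
    by (rule eval_point_proj[OF L e])
      (simp add: algebra_hom_mult[OF leib_eval_hom] leib_eval_var b)
  then show ?thesis
    by (simp add: proj_comb_def h.sum h.scale scale_sum_left)
qed

text \<open>One more than the largest index in the word, so \<open>word_bound t \<le> n\<close> says
  that only the first \<open>n\<close> variables occur.\<close>

primrec word_bound :: "word \<Rightarrow> nat"
  where
    "word_bound (Letter i) = Suc i"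
  | "word_bound (Prod s t) = max (word_bound s) (word_bound t)"

section \<open>Consequences of two of the identities\<close>

text \<open>Both identities are stated for arbitrary elements in place of variables, which is the
  form they take in a T-ideal after substitution.\<close>

locale two_identities =
  fixes J :: "'k::{field,finite} leib set"
  assumes T_ideal: "T_ideal J"
    and metabelian: "(w * x) * (y * z) \<in> J"
    and power_identity: "foldl (*) x (replicate CARD('k) y @ replicate (CARD('k) - 1) x)
       - foldl (*) x (y # replicate (CARD('k) - 1) x)
       - foldl (*) x (replicate CARD('k) y) + x * y \<in> J"
begin

lemma subspace: "free_leibniz.subspace J"
  using T_ideal by (simp add: T_ideal_def)

lemmas J_zero = free_leibniz.subspace_0[OF subspace]
  and J_add = free_leibniz.subspace_add[OF subspace]
  and J_diff = free_leibniz.subspace_diff[OF subspace]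
  and J_neg = free_leibniz.subspace_neg[OF subspace]
  and J_scale = free_leibniz.subspace_scale[OF subspace]
  and J_sum = free_leibniz.subspace_sum[OF subspace]

lemma J_mult: "f \<in> J \<Longrightarrow> f * g \<in> J" "f \<in> J \<Longrightarrow> g * f \<in> J"
  using T_ideal by (auto simp: T_ideal_def)

lemma J_right_act: "u \<in> J \<Longrightarrow> right_act x p u \<in> J"
  by (induction p) (simp_all add: J_zero J_add J_scale J_mult)

lemma J_point_proj: "u \<in> J \<Longrightarrow> point_proj \<tau> n u \<in> J"
  by (induction n arbitrary: u) (simp_all add: J_right_act)

lemma J_trans: "x - y \<in> J \<Longrightarrow> y - z \<in> J \<Longrightarrow> x - z \<in> J"
  using J_add[of "x - y" "y - z"] by simp

lemma J_cong: "x - y \<in> J \<Longrightarrow> y \<in> J \<Longrightarrow> x \<in> J"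
  using J_add[of "x - y" y] by simp

lemma J_cong': "x - y \<in> J \<Longrightarrow> x \<in> J \<Longrightarrow> y \<in> J"
  using J_diff[of x "x - y"] by simp

lemma J_cancel:
  assumes "x - y - z + w \<in> J" "x \<in> J" "y \<in> J"
  shows "z - w \<in> J"
proof -
  have "x - y - (x - y - z + w) = z - w"
    by simp
  then show ?thesis
    using assms by (metis J_diff)
qed

text \<open>Defined by annihilation and not as a span, because these are the only properties of the
  derived algebra that matter.\<close>

definition derived :: "'k leib set"
  where "derived = {u. (\<forall>x y. (x * y) * u \<in> J \<and> u * (x * y) \<in> J)}"

lemma derived_mult [intro]: "x * y \<in> derived"
  by (simp add: derived_def metabelian)

lemma derived_add: "u \<in> derived \<Longrightarrow> w \<in> derived \<Longrightarrow> u + w \<in> derived"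
  by (simp add: derived_def free_leibniz.mult_add_left free_leibniz.mult_add_right J_add)

lemma derived_scale: "u \<in> derived \<Longrightarrow> leib_scale c u \<in> derived"
  by (simp add: derived_def free_leibniz.mult_scale_left free_leibniz.mult_scale_right J_scale)

lemma derived_zero: "0 \<in> derived"
  by (simp add: derived_def J_zero)

lemma derived_sum: "(\<And>a. a \<in> A \<Longrightarrow> f a \<in> derived) \<Longrightarrow> sum f A \<in> derived"
  by (induction A rule: infinite_finite_induct) (auto simp: derived_zero derived_add)

lemma derived_right_act: "u \<in> derived \<Longrightarrow> right_act x p u \<in> derived"
  by (induction p) (auto simp: derived_zero derived_add derived_scale derived_mult)

lemma foldl_replicate_Suc: "foldl (*) u (replicate (Suc k) x) = foldl (*) u (replicate k x) * x"
  for u x :: "'k leib"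
  by (simp only: replicate_append_same[symmetric] replicate_Suc foldl_append foldl_Cons foldl_Nil)

section \<open>Right multiplications modulo the ideal\<close>

text \<open>The Leibniz identity rewrites the difference as \<open>u * (x * y)\<close>, which
  \<open>derived\<close> puts into the ideal.\<close>

lemma right_mult_comm:
  assumes "u \<in> derived"
  shows "u * x * y - u * y * x \<in> J"
proof -
  have "u * (x * y) \<in> J"
    using assms by (simp add: derived_def)
  then show ?thesis
    unfolding free_leibniz.leibniz[of u x y] .
qed

text \<open>Substituting \<open>u\<close> for the first variable of the last identity kills the terms that end
  in a right multiplication by \<open>u\<close>.\<close>

lemma right_mult_power:
  assumes u: "u \<in> derived"
  shows "foldl (*) u (replicate CARD('k) x) - u * x \<in> J"
proof -
  \<comment> \<open>Since \<open>q\<close> is at least 2, the exponent \<open>q - 1 = m + 1\<close>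
    is positive and a factor \<open>u\<close> really occurs.\<close>
  obtain m where m: "CARD('k) = Suc (Suc m)"
    by (rule card_field_Suc_Suc)
  have tail: "foldl (*) (y * z) (replicate (Suc m) u) \<in> J" for y z
  proof (induction m)
    case 0
    then show ?case
      using u by (simp add: derived_def)
  next
    case (Suc m)
    then show ?case
      unfolding foldl_replicate_Suc[of _ "Suc m"] by (rule J_mult)
  qed
  have "foldl (*) u (replicate CARD('k) x @ replicate (CARD('k) - 1) u) \<in> J"
    unfolding foldl_append m foldl_replicate_Suc[of _ "Suc m"] using tail by simp
  moreover have "foldl (*) u (x # replicate (CARD('k) - 1) u) \<in> J"
    using tail by (simp add: m)
  ultimately show ?thesis
    by (rule J_cancel[OF power_identity])
qed

text \<open>Such a polynomial is a multiple of \<open>X^q - X\<close>, which acts as zero by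
  \<open>right_mult_power\<close>. Hence only the function defined by a polynomial matters for its
  action modulo the ideal.\<close>

lemma right_act_vanishing:
  assumes "u \<in> derived" "\<And>c. poly p c = 0"
  shows "right_act x p u \<in> J"
proof -
  obtain r where "p = r * (monom 1 CARD('k) - monom 1 1)"
    using field_poly_dvd_vanishing[OF assms(2)] by (elim dvdE) (simp only: mult.commute)
  then have "right_act x p u = right_act x r (right_act x (monom 1 CARD('k) - monom 1 1) u)"
    by (simp only: right_act_mult)
  moreover have "right_act x (monom 1 CARD('k) - monom 1 1) u \<in> J"
    unfolding right_act_diff right_act_monom using right_mult_power[OF assms(1), of x] by simp
  ultimately show ?thesis
    by (simp only: J_right_act)
qed

lemma right_act_commute:
  assumes u: "u \<in> derived"
  shows "right_act y p u * x - right_act y p (u * x) \<in> J"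
proof (induction p)
  case (pCons a p)
  have "right_act y p u * y * x - right_act y p u * x * y \<in> J"
    by (intro right_mult_comm derived_right_act u)
  moreover have "right_act y p u * x * y - right_act y p (u * x) * y \<in> J"
    using J_mult(1)[OF pCons.IH] by (simp add: free_leibniz.mult_diff_left)
  ultimately have "right_act y p u * y * x - right_act y p (u * x) * y \<in> J"
    by (rule J_trans)
  then show ?case
    by (simp add: free_leibniz.mult_add_left free_leibniz.mult_scale_left)
qed (simp add: J_zero)

lemma point_proj_commute:
  "u \<in> derived \<Longrightarrow> point_proj \<tau> n u * x - point_proj \<tau> n (u * x) \<in> J"
proof (induction n arbitrary: u)
  case (Suc n)
  let ?a = "right_act (var n) (point_poly (\<tau> n))"
  have "point_proj \<tau> n (?a u) * x - point_proj \<tau> n (?a u * x) \<in> J"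
    using Suc by (simp add: derived_right_act)
  moreover have "point_proj \<tau> n (?a u * x) - point_proj \<tau> n (?a (u * x)) \<in> J"
    using J_point_proj[OF right_act_commute[OF Suc.prems]] by (simp add: point_proj.diff)
  ultimately show ?case
    unfolding point_proj.simps by (rule J_trans)
qed (simp add: J_zero)

text \<open>The factor for \<open>var i\<close> produces an eigenvector because
  \<open>(X - c) * point_poly c\<close> vanishes at every point of the field; the factors applied
  after it commute with right multiplication modulo the ideal.\<close>

lemma point_proj_eigen:
  "u \<in> derived \<Longrightarrow> i < n \<Longrightarrow> point_proj \<tau> n u * var i - leib_scale (\<tau> i) (point_proj \<tau> n u) \<in> J"
proof (induction n arbitrary: u)
  case (Suc n)
  let ?a = "right_act (var n) (point_poly (\<tau> n)) u"
  have a: "?a \<in> derived"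
    using Suc.prems by (simp add: derived_right_act)
  show ?case
  proof (cases "i = n")
    case True
    have "right_act (var n) ([:0, 1:] * point_poly (\<tau> n) - smult (\<tau> n) (point_poly (\<tau> n))) u \<in> J"
      by (rule right_act_vanishing) (use Suc.prems in \<open>auto simp: poly_point_poly\<close>)
    then have "?a * var n - leib_scale (\<tau> n) ?a \<in> J"
      unfolding right_act_diff right_act_mult right_act_X right_act_smult .
    from J_point_proj[OF this, of \<tau> n]
    have "point_proj \<tau> n (?a * var n) - leib_scale (\<tau> n) (point_proj \<tau> n ?a) \<in> J"
      by (simp add: point_proj.diff point_proj.scale)
    with point_proj_commute[OF a] show ?thesis
      unfolding True point_proj.simps by (rule J_trans)
  next
    case False
    then show ?thesis
      using Suc a by simp
  qed
qed simp

text \<open>The indicators of all points sum to the constant function 1, so modulo the ideal an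
  element of \<open>derived\<close> is the sum of its projections.\<close>

lemma in_J_if_point_proj:
  assumes "u \<in> derived" "\<And>\<tau>. point_proj \<tau> n u \<in> J"
  shows "u \<in> J"
  using assms
proof (induction n arbitrary: u)
  case (Suc n)
  have "right_act (var n) (point_poly c) u \<in> J" for c
  proof (rule Suc.IH)
    show "right_act (var n) (point_poly c) u \<in> derived"
      using Suc.prems by (simp add: derived_right_act)
    show "point_proj \<tau> n (right_act (var n) (point_poly c) u) \<in> J" for \<tau>
    proof -
      \<comment> \<open>The first \<open>n\<close> factors do not see coordinate \<open>n\<close>,
        so it may be set to the desired \<open>c\<close>.\<close>
      have "point_proj (\<tau>(n := c)) n w = point_proj \<tau> n w" for w
        by (rule point_proj_cong) simp
      then show ?thesis
        using Suc.prems(2)[of "\<tau>(n := c)"] unfolding point_proj.simps fun_upd_same by simp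
    qed
  qed
  then have "right_act (var n) (\<Sum>c\<in>UNIV. point_poly c) u \<in> J"
    unfolding right_act_sum by (rule J_sum)
  moreover have "right_act (var n) (1 - (\<Sum>c\<in>UNIV. point_poly c)) u \<in> J"
    by (rule right_act_vanishing) (use Suc.prems in \<open>simp_all add: poly_sum poly_point_poly\<close>)
  then have "u - right_act (var n) (\<Sum>c\<in>UNIV. point_poly c) u \<in> J"
    by (simp add: right_act_diff)
  ultimately show ?case
    by (rule J_cong[rotated])
qed simp

text \<open>In the power identity the first three terms are products multiplied by a last factor
  \<open>x\<close> or \<open>y\<close>, because \<open>q\<close> is at least 2. Their projections
  vanish by hypothesis, which leaves that of \<open>x * y\<close>; here \<open>x\<close> itself need
  not lie in \<open>derived\<close>.\<close>

lemma point_proj_annihilated: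
  assumes x: "\<And>u. u \<in> derived \<Longrightarrow> point_proj \<tau> n u * x \<in> J"
    and y: "\<And>u. u \<in> derived \<Longrightarrow> point_proj \<tau> n u * y \<in> J"
  shows "point_proj \<tau> n (x * y) \<in> J"
proof -
  obtain m where m: "CARD('k) = Suc (Suc m)"
    by (rule card_field_Suc_Suc)
  have x': "point_proj \<tau> n (u * x) \<in> J" and y': "point_proj \<tau> n (u * y) \<in> J" if "u \<in> derived" for u
    using J_cong'[OF point_proj_commute] x y that by blast+
  have der: "foldl (*) (u * w) zs \<in> derived" for u w and zs :: "'k leib list"
    by (induction zs arbitrary: u w) auto
  have 1: "point_proj \<tau> n (foldl (*) x (replicate CARD('k) y @ replicate (CARD('k) - 1) x)) \<in> J"
    unfolding m diff_Suc_1 foldl_append foldl_replicate_Suc[of _ m]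
    using x'[OF der[of x y "replicate (Suc m) y @ replicate m x"]] by simp
  have 2: "point_proj \<tau> n (foldl (*) x (y # replicate (CARD('k) - 1) x)) \<in> J"
    unfolding m diff_Suc_1 foldl_Cons foldl_replicate_Suc by (intro x' der)
  have 3: "point_proj \<tau> n (foldl (*) x (replicate CARD('k) y)) \<in> J"
    unfolding m foldl_replicate_Suc[of _ "Suc m"] by (intro y') (simp add: der)
  have "point_proj \<tau> n (foldl (*) x (replicate CARD('k) y @ replicate (CARD('k) - 1) x))
       - point_proj \<tau> n (foldl (*) x (y # replicate (CARD('k) - 1) x))
       - point_proj \<tau> n (foldl (*) x (replicate CARD('k) y)) + point_proj \<tau> n (x * y) \<in> J"
    using J_point_proj[OF power_identity, of \<tau> n x y]
    unfolding point_proj.diff point_proj.add .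
  from J_cong'[OF J_cancel[OF this 1 2] 3] show ?thesis .
qed

text \<open>A letter acts by its eigenvalue, and a longer word is itself a product, so it
  annihilates \<open>derived\<close>.\<close>

lemma point_proj_mult_word:
  assumes u: "u \<in> derived" and "word_bound t \<le> n"
  shows "point_proj \<tau> n (u * word_eval (*) var t)
    - leib_scale (case t of Letter i \<Rightarrow> \<tau> i | Prod _ _ \<Rightarrow> 0) (point_proj \<tau> n u) \<in> J"
proof (cases t)
  case (Letter i)
  with assms have "i < n"
    by simp
  have "point_proj \<tau> n (u * var i) - point_proj \<tau> n u * var i \<in> J"
    using J_neg[OF point_proj_commute[OF u]] by simp
  then have "point_proj \<tau> n (u * var i) - leib_scale (\<tau> i) (point_proj \<tau> n u) \<in> J"
    using point_proj_eigen[OF u \<open>i < n\<close>] by (rule J_trans)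
  then show ?thesis
    by (simp add: Letter)
next
  case (Prod s s')
  have "u * (word_eval (*) var s * word_eval (*) var s') \<in> J"
    using u by (simp add: derived_def)
  then show ?thesis
    by (simp add: Prod J_point_proj)
qed

section \<open>Reduction of projected products to bilinear combinations\<close>

definition reducible :: "(nat \<Rightarrow> 'k) \<Rightarrow> nat \<Rightarrow> 'k leib \<Rightarrow> bool"
  where "reducible \<tau> n u \<longleftrightarrow> (\<exists>\<gamma>. point_proj \<tau> n u - proj_comb \<tau> n \<gamma> \<in> J)"

lemma reducible_var_mult_var:
  assumes "i < n" "j < n"
  shows "reducible \<tau> n (var i * var j)"
proof -
  \<comment> \<open>The matrix unit at \<open>(i, j)\<close>, as nested conditionals so that the two
    sums collapse one after the other.\<close>
  let ?\<gamma> = "\<lambda>i' j'. if i' = i then if j' = j then 1 else 0 else 0"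
  have "leib_scale (?\<gamma> i' j') (point_proj \<tau> n (var i' * var j')) =
      (if i' = i then if j' = j then point_proj \<tau> n (var i * var j) else 0 else 0)" for i' j'
    by simp
  then have "proj_comb \<tau> n ?\<gamma> = (\<Sum>i'<n. \<Sum>j'<n.
      if i' = i then if j' = j then point_proj \<tau> n (var i * var j) else 0 else 0)"
    by (simp only: proj_comb_def)
  also have "\<dots> = (\<Sum>i'<n. if i' = i then
      \<Sum>j'<n. if j' = j then point_proj \<tau> n (var i * var j) else 0 else 0)"
    by (intro sum.cong) auto
  also have "\<dots> = point_proj \<tau> n (var i * var j)"
    using assms by simp
  finally show ?thesis
    unfolding reducible_def by (metis J_zero diff_self)
qed

lemma reducible_add:
  assumes "reducible \<tau> n u" "reducible \<tau> n w"
  shows "reducible \<tau> n (u + w)"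
proof -
  obtain \<gamma> \<delta> where "point_proj \<tau> n u - proj_comb \<tau> n \<gamma> \<in> J" "point_proj \<tau> n w - proj_comb \<tau> n \<delta> \<in> J"
    using assms by (auto simp: reducible_def)
  then have "point_proj \<tau> n u - proj_comb \<tau> n \<gamma> + (point_proj \<tau> n w - proj_comb \<tau> n \<delta>) \<in> J"
    by (rule J_add)
  also have "point_proj \<tau> n u - proj_comb \<tau> n \<gamma> + (point_proj \<tau> n w - proj_comb \<tau> n \<delta>) =
      point_proj \<tau> n (u + w) - proj_comb \<tau> n (\<lambda>i j. \<gamma> i j + \<delta> i j)"
    by (simp add: proj_comb_def point_proj.add free_leibniz.scale_left_distrib sum.distrib)
  finally show ?thesis
    unfolding reducible_def by blast
qed

lemma reducible_scale:
  assumes "reducible \<tau> n u"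
  shows "reducible \<tau> n (leib_scale c u)"
proof -
  obtain \<gamma> where "point_proj \<tau> n u - proj_comb \<tau> n \<gamma> \<in> J"
    using assms by (auto simp: reducible_def)
  then have "leib_scale c (point_proj \<tau> n u - proj_comb \<tau> n \<gamma>) \<in> J"
    by (rule J_scale)
  also have "leib_scale c (point_proj \<tau> n u - proj_comb \<tau> n \<gamma>) =
      point_proj \<tau> n (leib_scale c u) - proj_comb \<tau> n (\<lambda>i j. c * \<gamma> i j)"
    by (simp add: proj_comb_def point_proj.scale free_leibniz.scale_right_diff_distrib
        free_leibniz.scale_sum_right)
  finally show ?thesis
    unfolding reducible_def by blast
qed

lemma reducible_cong:
  assumes "point_proj \<tau> n u - point_proj \<tau> n w \<in> J" "reducible \<tau> n w"
  shows "reducible \<tau> n u"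
  using assms J_trans unfolding reducible_def by blast

lemma reducible_zero: "reducible \<tau> n 0"
  unfolding reducible_def
  by (rule exI[of _ "\<lambda>_ _. 0"]) (simp add: proj_comb_def point_proj.zero J_zero)

lemma reducible_sum: "(\<And>a. a \<in> A \<Longrightarrow> reducible \<tau> n (f a)) \<Longrightarrow> reducible \<tau> n (sum f A)"
  by (induction A rule: infinite_finite_induct) (auto simp: reducible_zero reducible_add)

lemma reducible_mult_word:
  assumes "u \<in> derived" "word_bound t \<le> n" "reducible \<tau> n u"
  shows "reducible \<tau> n (u * word_eval (*) var t)"
proof (rule reducible_cong)
  let ?c = "case t of Letter i \<Rightarrow> \<tau> i | Prod _ _ \<Rightarrow> 0"
  show "point_proj \<tau> n (u * word_eval (*) var t) - point_proj \<tau> n (leib_scale ?c u) \<in> J"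
    using point_proj_mult_word[OF assms(1,2)] by (simp add: point_proj.scale)
  show "reducible \<tau> n (leib_scale ?c u)"
    by (rule reducible_scale) fact
qed

text \<open>The Leibniz identity splits a product on the right into two products whose left factors
  are again a variable times a shorter word.\<close>

lemma reducible_var_mult_word:
  "i < n \<Longrightarrow> word_bound t \<le> n \<Longrightarrow> reducible \<tau> n (var i * word_eval (*) var t)"
proof (induction t)
  case (Letter j)
  then show ?case
    by (simp add: reducible_var_mult_var)
next
  case (Prod s t)
  let ?s = "word_eval (*) var s" and ?t = "word_eval (*) var t"
  have "reducible \<tau> n (var i * ?s * ?t + leib_scale (- 1) (var i * ?t * ?s))"
    using Prod by (intro reducible_add reducible_scale reducible_mult_word[OF derived_mult]) auto
  then show ?case
    by (simp add: free_leibniz.leibniz[of "var i" ?s ?t])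
qed

text \<open>If the left word is a product, it lies in \<open>derived\<close> and the right word only
  contributes a scalar; otherwise the left word is a variable.\<close>

lemma reducible_product:
  "word_bound s \<le> n \<Longrightarrow> word_bound t \<le> n \<Longrightarrow>
    reducible \<tau> n (word_eval (*) var s * word_eval (*) var t)"
proof (induction s arbitrary: t)
  case (Prod s s')
  then show ?case
    by (auto intro!: reducible_mult_word[OF derived_mult])
qed (simp add: reducible_var_mult_word)

text \<open>By the two conditions the combination does not change when every variable \<open>x\<^sub>i\<close> is replaced by
  \<open>x\<^sub>i - \<tau>\<^sub>i y\<close>. If \<open>y\<close> is a linear form with \<open>\<tau>(y) = 1\<close>, these differences vanish at \<open>\<tau>\<close>.\<close>

lemma proj_comb_in_J:
  assumes row: "\<And>i. i < n \<Longrightarrow> (\<Sum>j<n. \<gamma> i j * \<tau> j) = 0"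
    and col: "\<And>j. j < n \<Longrightarrow> (\<Sum>i<n. \<gamma> i j * \<tau> i) = 0"
  shows "proj_comb \<tau> n \<gamma> \<in> J"
proof -
  let ?P = "point_proj \<tau> n"
  obtain y where y: "\<And>u i. u \<in> derived \<Longrightarrow> i < n \<Longrightarrow> ?P u * (var i - leib_scale (\<tau> i) y) \<in> J"
  proof (cases "\<exists>k<n. \<tau> k \<noteq> 0")
    case True
    then obtain k where k: "k < n" "\<tau> k \<noteq> 0"
      by blast
    let ?y = "leib_scale (inverse (\<tau> k)) (var k)"
    have "?P u * (var i - leib_scale (\<tau> i) ?y) \<in> J" if "u \<in> derived" "i < n" for u i
    proof -
      have "?P u * var i - leib_scale (\<tau> i) (?P u)
          - leib_scale (\<tau> i * inverse (\<tau> k)) (?P u * var k - leib_scale (\<tau> k) (?P u)) \<in> J"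
        by (intro J_diff J_scale point_proj_eigen that k)
      moreover have "\<tau> i * inverse (\<tau> k) * \<tau> k = \<tau> i"
        using k by simp
      ultimately show ?thesis
        by (simp add: free_leibniz.mult_diff_right free_leibniz.mult_scale_right
            free_leibniz.scale_right_diff_distrib)
    qed
    then show ?thesis
      by (rule that)
  next
    \<comment> \<open>No linear form in these variables has value 1 at a zero point, but
      \<open>y = 0\<close> serves: every variable already acts as zero.\<close>
    case False
    then have "?P u * (var i - leib_scale (\<tau> i) 0) \<in> J" if "u \<in> derived" "i < n" for u i
      using point_proj_eigen[OF that, of \<tau>] that by auto
    then show ?thesis
      by (rule that)
  qed
  define x where "x i = var i - leib_scale (\<tau> i) y" for i
  have expand: "leib_scale c (?P (x i * x j)) = leib_scale c (?P (var i * var j))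
      - leib_scale (c * \<tau> j) (?P (var i * y)) - leib_scale (c * \<tau> i) (?P (y * var j))
      + leib_scale (c * \<tau> j * \<tau> i) (?P (y * y))" for c i j
    by (simp add: x_def free_leibniz.mult_diff_right free_leibniz.mult_diff_left
        free_leibniz.mult_scale_right free_leibniz.mult_scale_left point_proj.add point_proj.diff point_proj.scale
        free_leibniz.scale_right_diff_distrib free_leibniz.scale_right_distrib algebra_simps)
  \<comment> \<open>The terms linear in \<open>y\<close> vanish by the row and the column condition
    respectively, the quadratic one by the row condition.\<close>
  have 1: "(\<Sum>i<n. \<Sum>j<n. leib_scale (\<gamma> i j * \<tau> j) (?P (var i * y))) = 0"
    by (simp add: row flip: free_leibniz.scale_sum_left)
  have 2: "(\<Sum>i<n. \<Sum>j<n. leib_scale (\<gamma> i j * \<tau> i) (?P (y * var j))) = 0"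
    by (subst sum.swap) (simp add: col flip: free_leibniz.scale_sum_left)
  have 3: "(\<Sum>i<n. \<Sum>j<n. leib_scale (\<gamma> i j * \<tau> j * \<tau> i) (?P (y * y))) = 0"
    by (simp add: row flip: free_leibniz.scale_sum_left sum_distrib_right)
  have "(\<Sum>i<n. \<Sum>j<n. leib_scale (\<gamma> i j) (?P (x i * x j))) = proj_comb \<tau> n \<gamma>"
    unfolding expand sum.distrib sum_subtractf 1 2 3 proj_comb_def by simp
  moreover have "(\<Sum>i<n. \<Sum>j<n. leib_scale (\<gamma> i j) (?P (x i * x j))) \<in> J"
    unfolding x_def by (intro J_sum J_scale point_proj_annihilated y) auto
  ultimately show ?thesis
    by simp
qed

end


section \<open>The algebra \<open>L\<^sub>2\<close>\<close>

text \<open>The identity map and evaluation at the variables are homomorphisms that agree on the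
  variables, hence equal.\<close>

lemma leib_word_expansion:
  "f = (\<Sum>w\<in>Poly_Mapping.keys (rep_leib f).
    leib_scale (Poly_Mapping.lookup (rep_leib f) w) (word_eval (*) var w))"
proof -
  have "algebra_hom leib_scale (*) leib_scale (*) (id :: 'a leib \<Rightarrow> _)"
    unfolding algebra_hom_def using free_leibniz.linear_id by simp
  then have "id = leib_eval leib_scale (*) (var :: nat \<Rightarrow> 'a leib)"
    by (rule free_leibniz.leib_eval_unique) simp
  then have "f = leib_eval leib_scale (*) var f"
    by (metis id_apply)
  then show ?thesis
    unfolding leib_eval_def na_eval_def .
qed

lemma T_ideal_Int: "T_ideal I \<Longrightarrow> T_ideal J \<Longrightarrow> T_ideal (I \<inter> J)"
  unfolding T_ideal_def by (auto intro!: free_leibniz.subspace_inter) blast+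

text \<open>An endomorphism followed by an evaluation is again an evaluation, which gives closure
  under endomorphisms.\<close>

lemma (in leibniz_algebra) T_ideal_identities: "T_ideal (identities scale mult)"
proof -
  interpret h: Vector_Spaces.linear leib_scale scale "leib_eval scale mult v" for v
    by (rule algebra_hom_linear[OF leib_eval_hom])
  have "leib_eval scale mult v (h f) = 0"
    if h: "algebra_hom leib_scale (*) leib_scale (*) h" and f: "f \<in> identities scale mult" for v h f
  proof -
    have "algebra_hom leib_scale (*) scale mult (leib_eval scale mult v \<circ> h)"
      using h leib_eval_hom[of v] unfolding algebra_hom_def
      by (auto intro: linear_compose Vector_Spaces.linear_compose)
    then have "leib_eval scale mult v \<circ> h = leib_eval scale mult (\<lambda>i. leib_eval scale mult v (h (var i)))"
      by (rule leib_eval_unique) simp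
    from fun_cong[OF this, of f] show ?thesis
      using f by (simp add: identities_def)
  qed
  then show ?thesis
    unfolding T_ideal_def identities_def
    by (auto simp: free_leibniz.subspace_def h.zero h.add h.scale algebra_hom_mult[OF leib_eval_hom])
qed

section \<open>Multiplication and evaluations in the three-dimensional algebra\<close>

locale L2_algebra = leibniz_algebra scale mult
  for scale :: "'k::{field,finite} \<Rightarrow> 'l::ab_group_add \<Rightarrow> 'l" and mult :: "'l \<Rightarrow> 'l \<Rightarrow> 'l" +
  fixes e1 e2 e3 :: 'l and \<alpha> :: 'k
  assumes alpha: "\<alpha> \<noteq> 0"
    and basis: "is_basis {e1, e2, e3}"
    and products: "mult e1 e3 = scale \<alpha> e1" "mult e3 e2 = e2" "mult e2 e3 = - e2"
      "mult e1 e1 = 0" "mult e1 e2 = 0" "mult e2 e1 = 0"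
      "mult e2 e2 = 0" "mult e3 e1 = 0" "mult e3 e3 = 0"
begin

lemma nonzero: "e1 \<noteq> 0" "e2 \<noteq> 0"
  using basis dependent_zero[of "{e1, e2, e3}"] by (auto simp: is_basis_def)

lemma coordinates: "\<exists>a b c. x = scale a e1 + scale b e2 + scale c e3"
proof -
  have "x \<in> span {e1, e2, e3}"
    using basis by (simp add: is_basis_def)
  then obtain a b c where "x - scale a e1 - scale b e2 - scale c e3 = 0"
    by (auto simp: span_insert)
  then have "x = scale a e1 + scale b e2 + scale c e3"
    by (simp add: algebra_simps)
  then show ?thesis
    by blast
qed

text \<open>Products lie in the span of \<open>e1\<close> and \<open>e2\<close>, where right
  multiplication by \<open>y\<close> is diagonal with eigenvalues \<open>s y\<close> and
  \<open>t y\<close>. Identities thus become scalar equations in each coordinate.\<close>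

lemma multiplication_rule:
  obtains a s b t where
    "\<And>x y. mult x y = scale (a x * s y) e1 + scale (b x * t y - b y * t x) e2"
    "\<And>p r y. mult (scale p e1 + scale r e2) y = scale (p * s y) e1 + scale (r * t y) e2"
proof -
  obtain a b c where *: "x = scale (a x) e1 + scale (b x) e2 + scale (c x) e3" for x
    using coordinates by metis
  have "mult (scale p e1 + scale r e2 + scale d e3) (scale p' e1 + scale r' e2 + scale d' e3) =
    scale (p * (\<alpha> * d')) e1 + scale (r * - d' - r' * - d) e2" for p r d p' r' d'
    by (simp add: mult_add_left mult_add_right mult_scale_left mult_scale_right products algebra_simps)
  note rule = this
  show ?thesis
  \<comment> \<open>With \<open>c\<close> the coordinate at \<open>e3\<close>, the eigenvalues are
    \<open>\<alpha> * c y\<close> on \<open>e1\<close> and \<open>- c y\<close> on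
    \<open>e2\<close>.\<close>
  proof (rule that[of a "\<lambda>x. \<alpha> * c x" b "\<lambda>x. - c x"])
    show "mult x y = scale (a x * (\<alpha> * c y)) e1 + scale (b x * - c y - b y * - c x) e2" for x y
      using rule[of "a x" "b x" "c x" "a y" "b y" "c y"] by (simp only: *[symmetric])
    show "mult (scale p e1 + scale r e2) y = scale (p * (\<alpha> * c y)) e1 + scale (r * - c y) e2" for p r y
      using rule[of p r 0 "a y" "b y" "c y"] by (simp add: *[symmetric])
  qed
qed

text \<open>Setting one variable to \<open>e2\<close> and the others to 0 kills all products, since
  \<open>e2\<close> has square zero, and isolates the coefficient of that variable.\<close>

lemma no_linear_part:
  assumes "f \<in> identities scale mult" "w \<in> Poly_Mapping.keys (rep_leib f)"
  shows "\<exists>s t. w = Prod s t"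
proof (cases w)
  case (Letter k)
  let ?v = "\<lambda>i. if i = k then e2 else 0"
  let ?g = "\<lambda>w. scale (Poly_Mapping.lookup (rep_leib f) w) (word_eval mult ?v w)"
  have mem: "word_eval mult ?v w \<in> {0, e2}" for w
    by (induction w) (auto simp: products)
  have prod: "word_eval mult ?v (Prod s t) = 0" for s t
    using mem[of s] mem[of t] by (auto simp: products)
  have "0 = sum ?g (Poly_Mapping.keys (rep_leib f))"
    using assms(1) by (simp add: identities_def leib_eval_def na_eval_def)
  also have "\<dots> = sum ?g {w}"
  proof (rule sum.mono_neutral_right)
    show "\<forall>w'\<in>Poly_Mapping.keys (rep_leib f) - {w}. ?g w' = 0"
    proof
      fix w' assume "w' \<in> Poly_Mapping.keys (rep_leib f) - {w}"
      then show "?g w' = 0"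
        by (cases w') (use prod Letter in auto)
    qed
  qed (use assms in auto)
  also have "\<dots> = scale (Poly_Mapping.lookup (rep_leib f) w) e2"
    by (simp add: Letter)
  finally show ?thesis
    using assms(2) nonzero by (simp add: in_keys_iff)
qed simp

lemma coefficients_vanish:
  assumes "proj_comb \<tau> n \<gamma> \<in> identities scale mult" "k < n"
  shows "(\<Sum>j<n. \<gamma> k j * \<tau> j) = 0" "(\<Sum>i<n. \<gamma> i k * \<tau> i) = 0"
proof -
  have L: "leibniz_algebra scale mult"
    by unfold_locales
  have row: "(\<Sum>j<n. \<gamma> k j * \<tau> j) = 0" if "k < n" for k
  proof -
    \<comment> \<open>Dividing by \<open>\<alpha>\<close> gives \<open>e1\<close> the eigenvalue
      \<open>\<tau> i\<close>; the product of values \<open>i\<close> and \<open>j\<close> is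
      \<open>\<tau> j\<close> times \<open>e1\<close> if \<open>i = k\<close> and 0 otherwise, so
      row \<open>k\<close> is read off.\<close>
    let ?v = "\<lambda>i. scale (of_bool (i = k)) e1 + scale (\<tau> i / \<alpha>) e3"
    have "leib_eval scale mult ?v (proj_comb \<tau> n \<gamma>) =
        scale (\<Sum>i<n. \<Sum>j<n. \<gamma> i j * (of_bool (i = k) * \<tau> j)) e1"
      by (rule eval_proj_comb[OF L])
        (use alpha in \<open>simp_all add: mult_add_left mult_add_right mult_scale_left mult_scale_right products\<close>)
    moreover have "(\<Sum>i<n. \<Sum>j<n. \<gamma> i j * (of_bool (i = k) * \<tau> j)) =
        (\<Sum>i<n. if i = k then \<Sum>j<n. \<gamma> k j * \<tau> j else 0)"
      by (intro sum.cong) auto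
    moreover have "leib_eval scale mult ?v (proj_comb \<tau> n \<gamma>) = 0"
      using assms(1) by (simp add: identities_def)
    ultimately show ?thesis
      using nonzero that by simp
  qed
  then show "(\<Sum>j<n. \<gamma> k j * \<tau> j) = 0"
    using assms(2) by blast
  \<comment> \<open>The sign gives \<open>e2\<close> the eigenvalue \<open>\<tau> i\<close>. Both
    orders of multiplication contribute, so this yields row sum minus column sum, and the row sum is
    already known to vanish.\<close>
  let ?v = "\<lambda>i. scale (of_bool (i = k)) e2 - scale (\<tau> i) e3"
  have "leib_eval scale mult ?v (proj_comb \<tau> n \<gamma>) =
      scale (\<Sum>i<n. \<Sum>j<n. \<gamma> i j * (of_bool (i = k) * \<tau> j - of_bool (j = k) * \<tau> i)) e2"
    by (rule eval_proj_comb[OF L])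
      (simp_all add: mult_diff_left mult_diff_right mult_scale_left mult_scale_right products algebra_simps)
  moreover have "(\<Sum>i<n. \<Sum>j<n. \<gamma> i j * (of_bool (i = k) * \<tau> j - of_bool (j = k) * \<tau> i)) =
      (\<Sum>i<n. of_bool (i = k) * (\<Sum>j<n. \<gamma> i j * \<tau> j)) - (\<Sum>i<n. \<Sum>j<n. if j = k then \<gamma> i k * \<tau> i else 0)"
    unfolding sum_subtractf[symmetric] sum_distrib_left
    by (intro sum.cong) (auto simp: algebra_simps)
  moreover have "leib_eval scale mult ?v (proj_comb \<tau> n \<gamma>) = 0"
    using assms(1) by (simp add: identities_def)
  ultimately show "(\<Sum>i<n. \<gamma> i k * \<tau> i) = 0"
    using nonzero row assms(2) by simp
qed

lemma identities_subset:
  assumes J: "two_identities J" and sub: "J \<subseteq> identities scale mult"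
  shows "identities scale mult \<subseteq> J"
proof
  fix f
  assume f: "f \<in> identities scale mult"
  interpret two_identities J by fact
  \<comment> \<open>The identities contain \<open>J\<close>, so they satisfy the same two identities
    and are closed under the projections.\<close>
  interpret T: two_identities "identities scale mult"
    using T_ideal_identities metabelian power_identity sub by unfold_locales auto
  let ?K = "Poly_Mapping.keys (rep_leib f)"
  let ?c = "Poly_Mapping.lookup (rep_leib f)"
  \<comment> \<open>All variables of the representative have index below \<open>n\<close>; the
    inserted 0 covers an empty support.\<close>
  define n where "n = Max (insert 0 (word_bound ` ?K))"
  have f_eq: "f = (\<Sum>w\<in>?K. leib_scale (?c w) (word_eval (*) var w))"
    by (rule leib_word_expansion)
  show "f \<in> J"
  proof (rule in_J_if_point_proj[where n = n])
    show "f \<in> derived"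
    proof (subst f_eq, intro derived_sum derived_scale)
      fix w
      assume "w \<in> ?K"
      then show "word_eval (*) var w \<in> derived"
        using no_linear_part[OF f] by force
    qed
    fix \<tau>
    have "reducible \<tau> n (word_eval (*) var w)" if w: "w \<in> ?K" for w
    proof -
      obtain s t where st: "w = Prod s t"
        using no_linear_part[OF f w] by blast
      have "word_bound w \<le> n"
        unfolding n_def using w by (intro Max_ge) auto
      then show ?thesis
        by (simp add: st reducible_product)
    qed
    then have "reducible \<tau> n f"
      by (subst f_eq) (intro reducible_sum reducible_scale)
    then obtain \<gamma> where \<gamma>: "point_proj \<tau> n f - proj_comb \<tau> n \<gamma> \<in> J"
      by (auto simp: reducible_def)
    moreover have "proj_comb \<tau> n \<gamma> \<in> identities scale mult"
      using T.J_cong'[of "point_proj \<tau> n f"] T.J_point_proj[OF f] \<gamma> sub by blast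
    then have "proj_comb \<tau> n \<gamma> \<in> J"
      by (intro proj_comb_in_J coefficients_vanish)
    ultimately show "point_proj \<tau> n f \<in> J"
      by (rule J_cong)
  qed
qed

section \<open>The six polynomials vanish on the algebra\<close>

lemma basis_identities:
  "{(var 1 * var 2) * (var 3 * var 4),
     lnprod [var 1, var 2, var 3] - lnprod [var 1, var 3, var 2]
       - lnprod [var 2, var 1, var 3] + lnprod [var 2, var 3, var 1]
       + lnprod [var 3, var 1, var 2] - lnprod [var 3, var 2, var 1],
     lnprod (replicate (CARD('k) + 1) (var 1)) - lnprod (replicate 2 (var 1)),
     lnprod ([var 1] @ replicate 2 (var 2) @ [var 3])
       - lnprod ([var 3] @ replicate 2 (var 2) @ [var 1] @ replicate (CARD('k) - 1) (var 3))
       + lnprod (replicate CARD('k) (var 3) @ replicate 2 (var 2) @ [var 1])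
       - lnprod ([var 1] @ replicate CARD('k) (var 3) @ replicate 2 (var 2)),
     lnprod ([var 1] @ replicate 2 (var 2) @ [var 3] @ replicate (CARD('k) - 1) (var 1))
       - lnprod ([var 1] @ replicate 2 (var 2) @ [var 3])
       - lnprod ([var 1] @ replicate CARD('k) (var 3) @ replicate 2 (var 2) @ replicate (CARD('k) - 1) (var 1))
       + lnprod ([var 1] @ replicate CARD('k) (var 3) @ replicate 2 (var 2)),
     lnprod ([var 1] @ replicate CARD('k) (var 2) @ replicate (CARD('k) - 1) (var 1))
       - lnprod ([var 1, var 2] @ replicate (CARD('k) - 1) (var 1))
       - lnprod ([var 1] @ replicate CARD('k) (var 2))
       + lnprod [var 1, var 2]} \<subseteq> identities scale mult"
proof -
  obtain a s b t where
    rule: "\<And>x y. mult x y = scale (a x * s y) e1 + scale (b x * t y - b y * t x) e2"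
      "\<And>p r y. mult (scale p e1 + scale r e2) y = scale (p * s y) e1 + scale (r * t y) e2"
    by (rule multiplication_rule) blast
  define pair where "pair p r = scale p e1 + scale r e2" for p r
  have mult_vars: "mult (v i) (v j) = pair (a (v i) * s (v j)) (b (v i) * t (v j) - b (v j) * t (v i))"
    for v :: "nat \<Rightarrow> 'l" and i j
    unfolding pair_def by (rule rule)
  have mult_pair: "mult (pair p r) y = pair (p * s y) (r * t y)" for p r y
    unfolding pair_def by (rule rule)
  have foldl_pair: "foldl mult (pair p r) (replicate k y) = pair (p * s y ^ k) (r * t y ^ k)" for p r k y
    by (induction k arbitrary: p r) (simp_all add: mult_pair mult.assoc)
  have pair_arith: "pair p r - pair p' r' = pair (p - p') (r - r')" "pair p r + pair p' r' = pair (p + p') (r + r')"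
    for p r p' r'
    by (simp_all add: pair_def scale_left_diff_distrib scale_left_distrib)
  have pair_zero: "pair p r = 0" if "p = 0" "r = 0" for p r
    using that by (simp add: pair_def)
  \<comment> \<open>The Leibniz identity turns this into a commutator of right multiplications on a
    pair, and diagonal operators commute.\<close>
  have metabelian: "mult (mult x y) (mult z w) = 0" for x y z w
  proof -
    have "mult x y = pair (a x * s y) (b x * t y - b y * t x)"
      unfolding pair_def by (rule rule)
    then show ?thesis
      by (simp add: leibniz mult_pair mult_ac)
  qed
  have replicate_2: "replicate 2 x = [x, x]" for x :: "'k leib"
    by (simp add: numeral_2_eq_2)
  obtain m where m: "CARD('k) = Suc (Suc m)"
    by (rule card_field_Suc_Suc)
  \<comment> \<open>Here \<open>m = q - 2\<close>. With this, the later case distinctions on which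
    eigenvalues are zero reduce each coordinate to field arithmetic.\<close>
  have power: "c ^ m = inverse c" if "c \<noteq> 0" for c :: 'k
    using finite_field_power_card[of c] that by (simp add: m field_simps)
  interpret h: Vector_Spaces.linear leib_scale scale "leib_eval scale mult v" for v
    by (rule algebra_hom_linear[OF leib_eval_hom])
  note eval = h.add h.diff algebra_hom_foldl[OF leib_eval_hom] algebra_hom_mult[OF leib_eval_hom] leib_eval_var
    mult_vars mult_pair foldl_pair pair_arith m
  have "\<forall>f\<in>{(var 1 * var 2) * (var 3 * var 4),
     lnprod [var 1, var 2, var 3] - lnprod [var 1, var 3, var 2]
       - lnprod [var 2, var 1, var 3] + lnprod [var 2, var 3, var 1]
       + lnprod [var 3, var 1, var 2] - lnprod [var 3, var 2, var 1],
     lnprod (replicate (CARD('k) + 1) (var 1)) - lnprod (replicate 2 (var 1)),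
     lnprod ([var 1] @ replicate 2 (var 2) @ [var 3])
       - lnprod ([var 3] @ replicate 2 (var 2) @ [var 1] @ replicate (CARD('k) - 1) (var 3))
       + lnprod (replicate CARD('k) (var 3) @ replicate 2 (var 2) @ [var 1])
       - lnprod ([var 1] @ replicate CARD('k) (var 3) @ replicate 2 (var 2)),
     lnprod ([var 1] @ replicate 2 (var 2) @ [var 3] @ replicate (CARD('k) - 1) (var 1))
       - lnprod ([var 1] @ replicate 2 (var 2) @ [var 3])
       - lnprod ([var 1] @ replicate CARD('k) (var 3) @ replicate 2 (var 2) @ replicate (CARD('k) - 1) (var 1))
       + lnprod ([var 1] @ replicate CARD('k) (var 3) @ replicate 2 (var 2)),
     lnprod ([var 1] @ replicate CARD('k) (var 2) @ replicate (CARD('k) - 1) (var 1))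
       - lnprod ([var 1, var 2] @ replicate (CARD('k) - 1) (var 1))
       - lnprod ([var 1] @ replicate CARD('k) (var 2))
       + lnprod [var 1, var 2]}. leib_eval scale mult v f = 0" for v
    unfolding ball_simps(5) ball_simps(7)
  proof (intro conjI TrueI, goal_cases)
    case 1
    show ?case
      by (simp add: algebra_hom_mult[OF leib_eval_hom] metabelian)
  next
    case 2
    show ?case
      by (simp add: eval, rule pair_zero; simp add: algebra_simps)
  next
    case 3
    show ?case
      by (simp add: eval replicate_2; rule pair_zero; cases "s (v (Suc 0)) = 0"; simp add: power)
  next
    case 4
    show ?case
      apply (simp add: eval replicate_2)
      apply (rule pair_zero)
       apply (cases "s (v (Suc 0)) = 0"; cases "s (v 2) = 0"; cases "s (v 3) = 0"; simp add: power field_simps)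
      apply (cases "t (v (Suc 0)) = 0"; cases "t (v 2) = 0"; cases "t (v 3) = 0"; simp add: power field_simps)
      done
  next
    case 5
    show ?case
      apply (simp add: eval replicate_2)
      apply (rule pair_zero)
       apply (cases "s (v (Suc 0)) = 0"; cases "s (v 2) = 0"; cases "s (v 3) = 0"; simp add: power field_simps)
      apply (cases "t (v (Suc 0)) = 0"; cases "t (v 2) = 0"; cases "t (v 3) = 0"; simp add: power field_simps)
      done
  next
    case 6
    show ?case
      apply (simp add: eval replicate_2)
      apply (rule pair_zero)
       apply (cases "s (v (Suc 0)) = 0"; cases "s (v 2) = 0"; simp add: power field_simps)
      apply (cases "t (v (Suc 0)) = 0"; cases "t (v 2) = 0"; simp add: power field_simps)
      done
  qed
  then show ?thesis
    by (auto simp: identities_def)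
qed

end

theorem theorem3p3:
  fixes scale :: "'k::{field,finite} \<Rightarrow> 'l::ab_group_add \<Rightarrow> 'l"
    and mult :: "'l \<Rightarrow> 'l \<Rightarrow> 'l"
    and e1 e2 e3 :: 'l
    and \<alpha> :: 'k
    and q :: nat
  assumes q: "q = CARD('k)"
    and alpha: "\<alpha> \<noteq> 0"
    and L2: "leibniz_algebra scale mult"
    and basis: "distinct [e1, e2, e3]" "vector_space.is_basis scale {e1, e2, e3}"
    and products: "mult e1 e3 = scale \<alpha> e1" "mult e3 e2 = e2" "mult e2 e3 = - e2"
    and zero_products: "mult e1 e1 = 0" "mult e1 e2 = 0" "mult e2 e1 = 0"
      "mult e2 e2 = 0" "mult e3 e1 = 0" "mult e3 e3 = 0"
  shows "T_ideal_basis
    {(var 1 * var 2) * (var 3 * var 4),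
     lnprod [var 1, var 2, var 3] - lnprod [var 1, var 3, var 2]
       - lnprod [var 2, var 1, var 3] + lnprod [var 2, var 3, var 1]
       + lnprod [var 3, var 1, var 2] - lnprod [var 3, var 2, var 1],
     lnprod (replicate (q + 1) (var 1)) - lnprod (replicate 2 (var 1)),
     lnprod ([var 1] @ replicate 2 (var 2) @ [var 3])
       - lnprod ([var 3] @ replicate 2 (var 2) @ [var 1] @ replicate (q - 1) (var 3))
       + lnprod (replicate q (var 3) @ replicate 2 (var 2) @ [var 1])
       - lnprod ([var 1] @ replicate q (var 3) @ replicate 2 (var 2)),
     lnprod ([var 1] @ replicate 2 (var 2) @ [var 3] @ replicate (q - 1) (var 1))
       - lnprod ([var 1] @ replicate 2 (var 2) @ [var 3])
       - lnprod ([var 1] @ replicate q (var 3) @ replicate 2 (var 2) @ replicate (q - 1) (var 1))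
       + lnprod ([var 1] @ replicate q (var 3) @ replicate 2 (var 2)),
     lnprod ([var 1] @ replicate q (var 2) @ replicate (q - 1) (var 1))
       - lnprod ([var 1, var 2] @ replicate (q - 1) (var 1))
       - lnprod ([var 1] @ replicate q (var 2))
       + lnprod [var 1, var 2]}
    (identities scale mult)"
proof -
  interpret leibniz_algebra scale mult by fact
  interpret L2_algebra scale mult e1 e2 e3 \<alpha>
    by unfold_locales fact+
  show ?thesis
    unfolding T_ideal_basis_def
  proof (intro conjI allI impI)
    let ?S = "{(var 1 * var 2) * (var 3 * var 4),
     lnprod [var 1, var 2, var 3] - lnprod [var 1, var 3, var 2]
       - lnprod [var 2, var 1, var 3] + lnprod [var 2, var 3, var 1]
       + lnprod [var 3, var 1, var 2] - lnprod [var 3, var 2, var 1],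
     lnprod (replicate (q + 1) (var 1)) - lnprod (replicate 2 (var 1)),
     lnprod ([var 1] @ replicate 2 (var 2) @ [var 3])
       - lnprod ([var 3] @ replicate 2 (var 2) @ [var 1] @ replicate (q - 1) (var 3))
       + lnprod (replicate q (var 3) @ replicate 2 (var 2) @ [var 1])
       - lnprod ([var 1] @ replicate q (var 3) @ replicate 2 (var 2)),
     lnprod ([var 1] @ replicate 2 (var 2) @ [var 3] @ replicate (q - 1) (var 1))
       - lnprod ([var 1] @ replicate 2 (var 2) @ [var 3])
       - lnprod ([var 1] @ replicate q (var 3) @ replicate 2 (var 2) @ replicate (q - 1) (var 1))
       + lnprod ([var 1] @ replicate q (var 3) @ replicate 2 (var 2)),
     lnprod ([var 1] @ replicate q (var 2) @ replicate (q - 1) (var 1))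
       - lnprod ([var 1, var 2] @ replicate (q - 1) (var 1))
       - lnprod ([var 1] @ replicate q (var 2))
       + lnprod [var 1, var 2]}"
    show "T_ideal (identities scale mult)"
      by (rule T_ideal_identities)
    show S: "?S \<subseteq> identities scale mult"
      unfolding q by (rule basis_identities)
    fix J :: "'k leib set"
    assume J: "T_ideal J \<and> ?S \<subseteq> J"
    \<comment> \<open>Intersecting with the identities provides the inclusion that
      \<open>identities_subset\<close> requires, and its conclusion still gives the inclusion in
      \<open>J\<close>.\<close>
    have "two_identities (J \<inter> identities scale mult)"
    proof
      show T: "T_ideal (J \<inter> identities scale mult)"
        using T_ideal_Int[OF conjunct1[OF J] T_ideal_identities] .
      \<comment> \<open>Substituting elements of the free algebra for the variables is an
        endomorphism, namely evaluation in the free algebra itself.\<close>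
      have subst: "leib_eval leib_scale (*) v f \<in> J \<inter> identities scale mult" if "f \<in> ?S" for v f
      proof -
        have "leib_eval leib_scale (*) v ` (J \<inter> identities scale mult) \<subseteq> J \<inter> identities scale mult"
          using T free_leibniz.leib_eval_hom unfolding T_ideal_def by metis
        moreover have "f \<in> J \<inter> identities scale mult"
          using subsetD[OF conjunct2[OF J] that] subsetD[OF S that] by (rule IntI)
        ultimately show ?thesis
          by (rule subsetD[OF _ imageI])
      qed
      interpret h: Vector_Spaces.linear leib_scale leib_scale "leib_eval leib_scale (*) v" for v
        by (rule algebra_hom_linear[OF free_leibniz.leib_eval_hom])
      note eval = h.add h.diff algebra_hom_foldl[OF free_leibniz.leib_eval_hom]
        algebra_hom_mult[OF free_leibniz.leib_eval_hom] free_leibniz.leib_eval_var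
      show "w * x * (y * z) \<in> J \<inter> identities scale mult" for w x y z
        using subst[of "var 1 * var 2 * (var 3 * var 4)" "\<lambda>i. if i = 1 then w else if i = 2 then x else if i = 3 then y else z"]
        by (simp add: eval)
      show "foldl (*) x (replicate CARD('k) y @ replicate (CARD('k) - 1) x)
          - foldl (*) x (y # replicate (CARD('k) - 1) x)
          - foldl (*) x (replicate CARD('k) y) + x * y \<in> J \<inter> identities scale mult" for x y
        using subst[of "lnprod ([var 1] @ replicate q (var 2) @ replicate (q - 1) (var 1))
          - lnprod ([var 1, var 2] @ replicate (q - 1) (var 1))
          - lnprod ([var 1] @ replicate q (var 2)) + lnprod [var 1, var 2]" "\<lambda>i. if i = 1 then x else y"]
        by (simp add: eval q)
    qed
    then show "identities scale mult \<subseteq> J"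
      using identities_subset by blast
  qed
qed

end
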